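(* If $G$ is a $2$-connected partial $2$-tree that contains an $n$-vertex path, then $G$ contains an induced path of size $\frac{\log (n-3)}{2}$.
   Context: The class of $k$-trees is defined recursively: any clique on $k$ vertices is a $k$-tree; and if $G$ has a vertex $v$ whose neighborhood is a clique of size exactly $k$ and $G\setminus v$ is a $k$-tree, then $G$ is a $k$-tree. A partial $k$-tree is any subgraph of a $k$-tree. The size of a path is its number of vertices. Logarithms are base 2. *)

theory Defs
  imports Complex_Main "Graph_Theory.Graph_Theory"
begin

text \<open>
  A finite simple undirected graph is a \<open>pair_graph\<close>: a finite loop-free pair digraph with a
  symmetric arc relation, each edge being the two opposite arcs.
\<close>

definition neighborhood :: "'a pair_pre_digraph \<Rightarrow> 'a \<Rightarrow> 'a set" where
  "neighborhood G v = {u. (v, u) \<in> parcs G}"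

definition induced_pair :: "'a pair_pre_digraph \<Rightarrow> 'a set \<Rightarrow> 'a pair_pre_digraph" where
  "induced_pair G S = \<lparr> pverts = pverts G \<inter> S, parcs = parcs G \<inter> S \<times> S \<rparr>"

lemma (in pair_wf_digraph) with_proj_induced_pair:
  "with_proj (induced_pair G S) = with_proj G \<restriction> (pverts G \<inter> S)"
  by (auto simp: with_proj_def induced_pair_def induce_subgraph_def
           dest: arc_fst_in_verts arc_snd_in_verts)

inductive k_tree :: "nat \<Rightarrow> 'a pair_pre_digraph \<Rightarrow> bool" for k where
  clique: "complete_digraph k (with_proj G) \<Longrightarrow> k_tree k G"
| extend: "\<lbrakk>pair_graph G; v \<in> pverts G;
            complete_digraph k (with_proj (induced_pair G (neighborhood G v)));
            k_tree k (induced_pair G (- {v}))\<rbrakk> \<Longrightarrow> k_tree k G"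

text \<open>
  The host \<open>k\<close>-tree may need vertices outside \<open>G\<close>, and the vertex type of \<open>G\<close> may be finite.
  Every \<open>k\<close>-tree is finite, hence isomorphic to one whose vertices are natural numbers, so
  ``subgraph of a \<open>k\<close>-tree'' is read up to isomorphism with the host on \<open>nat\<close>.
\<close>

definition partial_k_tree :: "nat \<Rightarrow> 'a pair_pre_digraph \<Rightarrow> bool" where
  "partial_k_tree k G \<longleftrightarrow>
     pair_graph G \<and>
     (\<exists>(T :: nat pair_pre_digraph) (H :: nat pair_pre_digraph).
        k_tree k T \<and> subgraph (with_proj H) (with_proj T) \<and>
        digraph_iso (with_proj G) (with_proj H))"

definition k_connected :: "nat \<Rightarrow> 'a pair_pre_digraph \<Rightarrow> bool" where
  "k_connected k G \<longleftrightarrow>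
     k < card (pverts G) \<and>
     (\<forall>X. X \<subseteq> pverts G \<and> card X < k \<longrightarrow> connected (with_proj (induced_pair G (- X))))"

definition induced_vpath :: "'a vwalk \<Rightarrow> 'a pair_pre_digraph \<Rightarrow> bool" where
  "induced_vpath p G \<longleftrightarrow>
     vpath p (with_proj G) \<and>
     parcs (induced_pair G (set p)) = set (vwalk_arcs p) \<union> (set (vwalk_arcs p))\<inverse>"

end

theory Submission
  imports Defs "HOL-Library.Sublist"
begin

text \<open>
  Let \<open>M\<close> be the maximal length of a cycle of \<open>G\<close>. By 2-connectivity the ends of the given path lie
  on a common cycle \<open>C\<close>. A subpath joining two vertices of \<open>C\<close> and otherwise avoiding \<open>C\<close> can
  replace either of the two arcs of \<open>C\<close> between them, so it has at most \<open>M - |C|/2\<close> edges; as the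
  path meets \<open>C\<close> at most \<open>|C|\<close> times, this yields \<open>2 (n - 1) \<le> M (M - 1)\<close>.

  Treewidth two means that chords of a cycle never cross: a vertex of the host 2-tree whose
  neighborhood is a single edge is incident to no chord, and a cycle through it can be shortened
  along that edge.

  On a cycle of length \<open>M\<close> without crossing chords there is a pair \<open>x, z\<close> separated by no chord and
  splitting the cycle into arcs with between \<open>M/3\<close> and \<open>2M/3\<close> edges. Descending into the larger half
  of an arc with \<open>l\<close> edges, one finds induced paths starting at its two ends with \<open>log l\<close> edges in
  total. Gluing these at \<open>x\<close> and at \<open>z\<close> gives an induced path with \<open>s\<close> vertices, where
  \<open>4\<^sup>s \<ge> 4 (M/3) (2M/3)\<close>.
\<close>

section \<open>Paths and circuits of a relation\<close>

definition path :: "('a \<Rightarrow> 'a \<Rightarrow> bool) \<Rightarrow> 'a list \<Rightarrow> bool" where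
  "path E p \<longleftrightarrow> p \<noteq> [] \<and> distinct p \<and> successively E p"

text \<open>An edge traversed back and forth counts as a circuit of length two.\<close>

definition circuit :: "('a \<Rightarrow> 'a \<Rightarrow> bool) \<Rightarrow> 'a list \<Rightarrow> bool" where
  "circuit E c \<longleftrightarrow> 2 \<le> length c \<and> path E c \<and> E (last c) (hd c)"

definition crossing_free :: "('a \<Rightarrow> 'a \<Rightarrow> bool) \<Rightarrow> 'a list \<Rightarrow> bool" where
  "crossing_free E w \<longleftrightarrow> (\<forall>a b c d. subseq [a, b, c, d] w \<longrightarrow> \<not> (E a c \<and> E b d))"

definition anticomplete :: "('a \<Rightarrow> 'a \<Rightarrow> bool) \<Rightarrow> 'a set \<Rightarrow> 'a set \<Rightarrow> bool" where
  "anticomplete E A B \<longleftrightarrow> A \<inter> B = {} \<and> (\<forall>a\<in>A. \<forall>b\<in>B. \<not> E a b)"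

fun chordless :: "('a \<Rightarrow> 'a \<Rightarrow> bool) \<Rightarrow> 'a list \<Rightarrow> bool" where
  "chordless E [] \<longleftrightarrow> True"
| "chordless E [x] \<longleftrightarrow> True"
| "chordless E (x # y # q) \<longleftrightarrow>
     E x y \<and> x \<notin> set (y # q) \<and> (\<forall>z\<in>set q. \<not> E x z) \<and> chordless E (y # q)"

lemma rotate_to_front:
  assumes "x \<in> set c"
  obtains k xs where "rotate k c = x # xs"
  using assms by (metis append_Cons in_set_conv_decomp rotate_append)

lemma successively_append_Cons_iff:
  "successively P (xs @ y # ys) \<longleftrightarrow> successively P (xs @ [y]) \<and> successively P (y # ys)"
  by (auto simp: successively_append_iff)

lemma path_append_ConsD:
  assumes "path E (xs @ y # ys)"
  shows "path E (xs @ [y])" "path E (y # ys)"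
  using assms successively_append_Cons_iff[of E xs y ys] by (auto simp: path_def)

lemma circuit_edge: "\<lbrakk>E x y; E y x; x \<noteq> y\<rbrakk> \<Longrightarrow> circuit E [x, y]"
  by (simp add: circuit_def path_def)

lemma circuit_append_commute: "circuit E (p @ q) \<Longrightarrow> circuit E (q @ p)"
  by (cases "p = []"; cases "q = []") (auto simp: circuit_def path_def successively_append_iff)

lemma circuit_rotate: "circuit E c \<Longrightarrow> circuit E (rotate k c)"
  using circuit_append_commute[of E "take (k mod length c) c" "drop (k mod length c) c"]
  by (simp add: rotate_drop_take)

lemma circuit_append_Cons_iff:
  "circuit E (x # ys @ z # ws) \<longleftrightarrow>
     distinct (x # ys @ z # ws) \<and> successively E (x # ys @ [z]) \<and> successively E (z # ws @ [x])"
  using successively_append_Cons_iff[of E "x # ys" z ws]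
    successively_append_iff[of E "z # ws" "[x]"]
  by (auto simp: circuit_def path_def)

lemma circuit_imp_paths:
  assumes "circuit E (x # ys @ z # ws)"
  shows "path E (x # ys @ [z])" "path E (z # ws @ [x])"
  using assms by (auto simp: circuit_append_Cons_iff path_def)

lemma circuit_split_at:
  assumes "circuit E c" "x \<in> set c" "z \<in> set c" "x \<noteq> z"
  obtains ys ws where "circuit E (x # ys @ z # ws)" "set (x # ys @ z # ws) = set c"
    "length (x # ys @ z # ws) = length c"
proof -
  obtain k xs where rotated: "rotate k c = x # xs" using rotate_to_front[OF assms(2)] .
  then have "z \<in> set xs" using assms(3,4) by (metis set_ConsD set_rotate)
  then obtain ys ws where "xs = ys @ z # ws" by (auto dest: split_list)
  then have split: "rotate k c = x # ys @ z # ws" using rotated by simp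
  then have "circuit E (x # ys @ z # ws)" using circuit_rotate[OF assms(1), of k] by simp
  moreover have "set (x # ys @ z # ws) = set c" "length (x # ys @ z # ws) = length c"
    using split by (metis set_rotate, metis length_rotate)
  ultimately show ?thesis using that by blast
qed

lemma circuit_ex_successor:
  assumes "circuit E c" "x \<in> set c"
  shows "\<exists>y. E x y"
proof -
  obtain k xs where "rotate k c = x # xs" using rotate_to_front[OF assms(2)] .
  then have "circuit E (x # xs)" using circuit_rotate[OF assms(1), of k] by simp
  then show ?thesis by (cases xs) (auto simp: circuit_def path_def)
qed

lemma circuit_map:
  assumes "circuit E c" "inj_on f (set c)"
    and "\<And>x y. \<lbrakk>x \<in> set c; y \<in> set c; E x y\<rbrakk> \<Longrightarrow> F (f x) (f y)"
  shows "circuit F (map f c)"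
proof -
  have "successively (\<lambda>x y. F (f x) (f y)) c"
    by (rule successively_mono[of E]) (use assms in \<open>auto simp: circuit_def path_def\<close>)
  moreover have "F (f (last c)) (f (hd c))" using assms(1,3) by (simp add: circuit_def path_def)
  ultimately show ?thesis using assms(1,2)
    by (simp add: circuit_def path_def distinct_map hd_map last_map successively_map)
qed

lemma crossing_freeD:
  "\<lbrakk>crossing_free E w; subseq [a, b, c, d] w; E a c\<rbrakk> \<Longrightarrow> \<not> E b d"
  unfolding crossing_free_def by blast

lemma crossing_free_subseq: "\<lbrakk>crossing_free E w; subseq v w\<rbrakk> \<Longrightarrow> crossing_free E v"
  unfolding crossing_free_def using subseq_order.trans by blast

lemma crossing_free_append_ConsD:
  assumes "crossing_free E (xs @ y # ys)"
  shows "crossing_free E (xs @ [y])" "crossing_free E (y # ys)"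
  using assms by (auto intro: crossing_free_subseq simp: subseq_append')

lemma crossing_free_if_length_less: "length w < 4 \<Longrightarrow> crossing_free E w"
  by (auto simp: crossing_free_def dest: list_emb_length)

lemma crossing_free_Cons:
  assumes "distinct r" "{u. E v u} \<subseteq> {hd r, last r}" "crossing_free E r"
  shows "crossing_free E (v # r)"
  unfolding crossing_free_def
proof (intro allI impI notI, elim conjE)
  fix a b c d
  assume subseq_abcd: "subseq [a, b, c, d] (v # r)" and chord_ac: "E a c" and chord_bd: "E b d"
  show False
  proof (cases "subseq [a, b, c, d] r")
    case True
    then show ?thesis using crossing_freeD[OF assms(3) _ chord_ac] chord_bd by blast
  next
    case False
    then have "a = v" and "subseq ([b] @ [c] @ [d]) r" using subseq_abcd by (auto split: if_splits)
    then obtain r1 r2 r3 where r_split: "r = r1 @ r2 @ r3"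
      and "b \<in> set r1" "c \<in> set r2" "d \<in> set r3"
      unfolding subseq_singleton_left[symmetric] by (blast dest: list_emb_appendD)
    then have "hd r \<in> set r1" "last r \<in> set r3" by (cases r1; cases r3; auto)+
    then have "c \<noteq> hd r" "c \<noteq> last r" using assms(1) r_split \<open>c \<in> set r2\<close> by auto
    then show ?thesis using assms(2) chord_ac \<open>a = v\<close> by blast
  qed
qed

lemma crossing_free_mapD:
  assumes "crossing_free F (map f w)"
    and "\<And>x y. \<lbrakk>x \<in> set w; y \<in> set w; E x y\<rbrakk> \<Longrightarrow> F (f x) (f y)"
  shows "crossing_free E w"
  unfolding crossing_free_def
proof (intro allI impI notI, elim conjE)
  fix a b c d
  assume subseq_abcd: "subseq [a, b, c, d] w" and "E a c" "E b d"
  have "set [a, b, c, d] \<subseteq> set w" by (blast elim: list_emb_set[OF subseq_abcd])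
  then have image: "F (f a) (f c)" "F (f b) (f d)"
    using assms(2) \<open>E a c\<close> \<open>E b d\<close> by auto
  have "subseq [f a, f b, f c, f d] (map f w)" using subseq_map[OF subseq_abcd, of f] by simp
  then show False using crossing_freeD[OF assms(1) _ image(1)] image(2) by blast
qed

lemma crossing_free_chord_separates:
  assumes "crossing_free E (x # as @ u # bs)" "E x u" "y \<in> set as" "v \<in> set bs"
  shows "\<not> E y v"
proof -
  have "subseq ([x] @ [y] @ [u] @ [v]) ([x] @ as @ [u] @ bs)"
    using assms(3,4) by (intro list_emb_append_mono) (auto simp: subseq_singleton_left)
  then show ?thesis using crossing_freeD[OF assms(1) _ assms(2)] by simp
qed

lemma anticomplete_mono:
  "\<lbrakk>anticomplete E A B; A' \<subseteq> A; B' \<subseteq> B\<rbrakk> \<Longrightarrow> anticomplete E A' B'"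
  unfolding anticomplete_def by blast

locale symmetric_relation =
  fixes E :: "'a \<Rightarrow> 'a \<Rightarrow> bool"
  assumes E_sym: "E x y \<Longrightarrow> E y x"
begin

lemma successively_rev_iff: "successively E (rev p) \<longleftrightarrow> successively E p"
  unfolding successively_rev using E_sym by (auto elim: successively_mono)

lemma anticomplete_commute: "anticomplete E A B \<Longrightarrow> anticomplete E B A"
  unfolding anticomplete_def using E_sym by blast

lemma crossing_free_append_commute:
  assumes "crossing_free E (p @ q)"
  shows "crossing_free E (q @ p)"
  unfolding crossing_free_def
proof (intro allI impI)
  fix a b c d
  assume "subseq [a, b, c, d] (q @ p)"
  then obtain xs ys where split: "[a, b, c, d] = xs @ ys" and "subseq xs q" "subseq ys p"
    by (auto simp: subseq_append_iff)
  then have "subseq (ys @ xs) (p @ q)" by (simp add: list_emb_append_mono)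
  then have "subseq [a, b, c, d] (p @ q) \<or> subseq [b, c, d, a] (p @ q) \<or>
      subseq [c, d, a, b] (p @ q) \<or> subseq [d, a, b, c] (p @ q)"
    using split by (auto simp: Cons_eq_append_conv)
  then show "\<not> (E a c \<and> E b d)"
    using crossing_freeD[OF assms] E_sym by meson
qed

lemma crossing_free_rotate: "crossing_free E (rotate k w) \<longleftrightarrow> crossing_free E w"
  unfolding rotate_drop_take
  using crossing_free_append_commute append_take_drop_id by metis

lemma crossing_free_Cons_clique_neighbors:
  assumes "circuit E (v # r)" "card {u. E v u} = 2"
    and clique: "\<And>x y. \<lbrakk>E v x; E v y; x \<noteq> y\<rbrakk> \<Longrightarrow> E x y"
    and delete: "circuit E r \<Longrightarrow> crossing_free E r"
  shows "crossing_free E (v # r)"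
proof (cases "length r < 3")
  case True
  then show ?thesis by (intro crossing_free_if_length_less) simp
next
  case False
  then have "r \<noteq> []" by auto
  then have path_r: "path E r" and ends: "E v (hd r)" "E v (last r)"
    using assms(1) E_sym by (auto simp: circuit_def path_def successively_Cons)
  have "hd r \<noteq> last r" using path_r False by (cases r) (auto simp: path_def)
  then have neighbors_v: "{u. E v u} = {hd r, last r}"
    using assms(2) ends by (intro card_seteq[symmetric]) (auto intro: card_ge_0_finite)
  have "circuit E r"
    using path_r False clique[OF ends(2,1)] \<open>hd r \<noteq> last r\<close> by (simp add: circuit_def)
  then show ?thesis using crossing_free_Cons[of r E v] path_r neighbors_v delete
    by (simp add: path_def)
qed

end

section \<open>Chordless paths in a circuit without crossing chords\<close>

lemma chordless_appendD: "chordless E (p @ q) \<Longrightarrow> chordless E q"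
proof (induction p)
  case (Cons x p)
  then show ?case by (cases "p @ q") auto
qed simp

lemma chordless_imp_path: "\<lbrakk>chordless E p; p \<noteq> []\<rbrakk> \<Longrightarrow> path E p"
  by (induction E p rule: chordless.induct) (auto simp: path_def)

lemma chordless_join:
  assumes "chordless E (p @ [u])" "chordless E (u # q)" "anticomplete E (set p) (set q)"
  shows "chordless E (p @ u # q)"
  using assms
proof (induction p)
  case (Cons x p)
  then show ?case
    using chordless_appendD[of E "[x]" "p @ [u]"]
    by (cases p) (auto simp: anticomplete_def)
qed simp

lemma chordless_shortcut:
  assumes "successively E p" "p \<noteq> []"
  shows "\<exists>q. chordless E q \<and> q \<noteq> [] \<and> hd q = hd p \<and> last q = last p \<and> set q \<subseteq> set p"
  using assms
proof (induction p)
  case (Cons x p)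
  show ?case
  proof (cases "p = []")
    case True
    then show ?thesis by (intro exI[of _ "[x]"]) auto
  next
    case False
    then obtain q where
      shortcut: "chordless E q" "q \<noteq> []" "hd q = hd p" "last q = last p" "set q \<subseteq> set p"
      using Cons by (auto simp: successively_Cons)
    have "\<exists>w\<in>set q. w = x \<or> E x w"
      using shortcut(2,3) Cons.prems(1) \<open>p \<noteq> []\<close> by (metis hd_in_set successively_Cons)
    from split_list_last_prop[OF this] obtain as w bs where
      split: "q = as @ w # bs" "w = x \<or> E x w" "\<forall>y\<in>set bs. y \<noteq> x \<and> \<not> E x y" by blast
    have tail: "chordless E (w # bs)" using shortcut(1) split(1) chordless_appendD by blast
    have ends: "last (w # bs) = last (x # p)" "set (w # bs) \<subseteq> set (x # p)"
      using shortcut(4,5) split(1) \<open>p \<noteq> []\<close> by auto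
    show ?thesis
    proof (cases "w = x")
      case True
      then show ?thesis using tail ends by (intro exI[of _ "w # bs"]) auto
    next
      case False
      then have "chordless E (x # w # bs)" using tail split(2,3) by auto
      then show ?thesis using ends by (intro exI[of _ "x # w # bs"]) auto
    qed
  qed
qed simp

lemma last_neighbor_split:
  assumes "successively E (x # ys)" "ys \<noteq> []" "distinct (ys @ zs)"
    and "crossing_free E (x # ys @ zs)"
  obtains as u bs where "ys = as @ u # bs" "E x u" "\<forall>y\<in>set bs. \<not> E x y"
    "anticomplete E (set as) (set (bs @ zs))"
proof -
  have "\<exists>u\<in>set ys. E x u" using assms(1,2) by (cases ys) auto
  from split_list_last_prop[OF this] obtain as u bs where
    ys_split: "ys = as @ u # bs" and adjacent: "E x u" and no_later: "\<forall>y\<in>set bs. \<not> E x y"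
    by blast
  have "anticomplete E (set as) (set (bs @ zs))"
    using crossing_free_chord_separates[of E x as u "bs @ zs"] assms(3,4) ys_split adjacent
    by (auto simp: anticomplete_def)
  then show ?thesis using that ys_split adjacent no_later by blast
qed

definition chordless_ends :: "('a \<Rightarrow> 'a \<Rightarrow> bool) \<Rightarrow> 'a \<Rightarrow> 'a list \<Rightarrow> 'a \<Rightarrow> nat \<Rightarrow> bool" where
  "chordless_ends E x ys z l \<longleftrightarrow>
     (\<exists>A B. chordless E (x # A) \<and> chordless E (z # B) \<and> set A \<subseteq> set ys \<and> set B \<subseteq> set ys \<and>
        l \<le> length A + length B)"

lemma chordless_ends_0: "chordless_ends E x ys z 0"
  unfolding chordless_ends_def by (intro exI[of _ "[]"]) simp

lemma chordless_ends_extend_left: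
  assumes "chordless_ends E u bs z l" "E x u" "\<forall>y\<in>set bs. \<not> E x y" "x \<notin> set (u # bs)"
  shows "chordless_ends E x (as @ u # bs) z (Suc l)"
proof -
  obtain A B where tails: "chordless E (u # A)" "chordless E (z # B)"
    "set A \<subseteq> set bs" "set B \<subseteq> set bs" "l \<le> length A + length B"
    using assms(1) unfolding chordless_ends_def by blast
  then have "chordless E (x # u # A)" using assms(2-4) by auto
  then show ?thesis
    unfolding chordless_ends_def using tails by (intro exI[of _ "u # A"] exI[of _ B]) auto
qed

definition separation ::
  "('a \<Rightarrow> 'a \<Rightarrow> bool) \<Rightarrow> 'a list \<Rightarrow> 'a \<Rightarrow> 'a list \<Rightarrow> 'a \<Rightarrow> 'a list \<Rightarrow> bool" where
  "separation E c x ys z ws \<longleftrightarrow>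
     (\<exists>k. rotate k c = x # ys @ z # ws) \<and> anticomplete E (set ys) (set ws)"

lemma separation_imp_anticomplete:
  "separation E c x ys z ws \<Longrightarrow> anticomplete E (set ys) (set ws)"
  by (simp add: separation_def)

lemma separation_set_length:
  assumes "separation E c x ys z ws"
  shows "set (x # ys @ z # ws) = set c" "length (x # ys @ z # ws) = length c"
  using assms unfolding separation_def by (metis set_rotate, metis length_rotate)

lemma separation_imp_circuit:
  "\<lbrakk>separation E c x ys z ws; circuit E c\<rbrakk> \<Longrightarrow> circuit E (x # ys @ z # ws)"
  unfolding separation_def using circuit_rotate by metis

lemma balanced_product_ge:
  fixes a b :: nat
  assumes "a + b \<le> 3 * a" "3 * a \<le> 2 * (a + b)"
  shows "2 * (a + b)\<^sup>2 \<le> 9 * (a * b)"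
proof -
  have "0 \<le> (2 * int a - int b) * (2 * int b - int a)"
    using assms by (intro mult_nonneg_nonneg) auto
  then have "int (2 * (a + b)\<^sup>2) \<le> int (9 * (a * b))"
    by (simp add: power2_eq_square algebra_simps)
  then show ?thesis by linarith
qed

context symmetric_relation
begin

lemma separation_imp_crossing_free:
  "\<lbrakk>separation E c x ys z ws; crossing_free E c\<rbrakk> \<Longrightarrow> crossing_free E (x # ys @ z # ws)"
  unfolding separation_def using crossing_free_rotate by metis

lemma chordless_rev: "chordless E p \<Longrightarrow> chordless E (rev p)"
proof (induction p rule: induct_list012)
  case (3 x y q)
  then have "chordless E (rev q @ [y])" "chordless E [y, x]"
    and "anticomplete E (set (rev q)) (set [x])"
    using E_sym by (auto simp: anticomplete_def)
  then show ?case using chordless_join[of E "rev q" y "[x]"] by simp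
qed auto

lemma chordless_rev_append:
  assumes "chordless E (u # p)" "chordless E (u # q)" "anticomplete E (set p) (set q)"
  shows "chordless E (rev p @ u # q)"
  using chordless_join[of E "rev p" u q] chordless_rev[OF assms(1)] assms(2,3) by simp

lemma chordless_adjacent_in_vwalk_arcs:
  assumes "chordless E p" "x \<in> set p" "y \<in> set p" "x \<noteq> y" "E x y"
  shows "(x, y) \<in> set (vwalk_arcs p) \<union> (set (vwalk_arcs p))\<inverse>"
  using assms
proof (induction p rule: induct_list012)
  case (3 x y q)
  then show ?case using E_sym by auto
qed auto

lemma chordless_extend_along:
  assumes "chordless E (u # B)" "path E (u # bs @ [z])" "anticomplete E (set B) (set (bs @ [z]))"
  obtains R where "chordless E (z # R @ u # B)" "set R \<subseteq> set bs"
proof -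
  have "successively E (rev (u # bs @ [z]))"
    using assms(2) unfolding successively_rev_iff path_def by blast
  from chordless_shortcut[OF this] obtain q where
    shortcut: "chordless E q" "q \<noteq> []" "hd q = z" "last q = u" "set q \<subseteq> set (u # bs @ [z])" by auto
  have "z \<noteq> u" using assms(2) by (auto simp: path_def)
  then obtain R where q_eq: "q = z # R @ [u]"
    using shortcut(2-4) by (metis append_butlast_last_id append_Cons last.simps list.collapse)
  have "distinct q" using chordless_imp_path[OF shortcut(1,2)] by (simp add: path_def)
  then have subset_bs: "set R \<subseteq> set bs" using shortcut(5) q_eq by auto
  then have "anticomplete E (set (z # R)) (set B)"
    using anticomplete_mono[OF anticomplete_commute[OF assms(3)], of "set (z # R)" "set B"] by auto
  then have "chordless E (z # R @ u # B)"
    using chordless_join[of E "z # R" u B] shortcut(1) q_eq assms(1) by simp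
  then show ?thesis using that subset_bs by blast
qed

lemma chordless_ends_extend_right:
  assumes "chordless_ends E x as u l" "path E (u # bs @ [z])"
    and "anticomplete E (set as) (set (bs @ [z]))"
  shows "chordless_ends E x (as @ u # bs) z (Suc l)"
proof -
  obtain A B where tails: "chordless E (x # A)" "chordless E (u # B)"
    "set A \<subseteq> set as" "set B \<subseteq> set as" "l \<le> length A + length B"
    using assms(1) unfolding chordless_ends_def by blast
  have "anticomplete E (set B) (set (bs @ [z]))"
    using anticomplete_mono[OF assms(3) tails(4)] by blast
  from chordless_extend_along[OF tails(2) assms(2) this]
  obtain R where "chordless E (z # R @ u # B)" "set R \<subseteq> set bs" .
  then show ?thesis
    unfolding chordless_ends_def using tails by (intro exI[of _ A] exI[of _ "R @ u # B"]) auto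
qed

lemma crossing_free_path_chordless_ends:
  assumes "path E (x # ys @ [z])" "crossing_free E (x # ys @ [z])"
  shows "\<exists>l. chordless_ends E x ys z l \<and> Suc (length ys) \<le> 2 ^ l"
  using assms
proof (induction "length ys" arbitrary: x ys z rule: less_induct)
  case less
  show ?case
  proof (cases "ys = []")
    case True
    then show ?thesis using chordless_ends_0 by (intro exI[of _ 0]) simp
  next
    case False
    have "successively E (x # ys)" "distinct (ys @ [z])" "x \<notin> set ys"
      using less.prems(1) successively_append_iff[of E "x # ys" "[z]"] by (auto simp: path_def)
    with False less.prems(2) obtain as u bs where ys_split: "ys = as @ u # bs" and adjacent: "E x u"
      and no_later: "\<forall>y\<in>set bs. \<not> E x y"
      and anticomplete_as: "anticomplete E (set as) (set (bs @ [z]))"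
      using last_neighbor_split[of E x ys "[z]"] by metis
    have left: "path E (x # as @ [u])" "crossing_free E (x # as @ [u])"
      and right: "path E (u # bs @ [z])" "crossing_free E (u # bs @ [z])"
      using path_append_ConsD[of E "x # as" u "bs @ [z]"] less.prems ys_split
        crossing_free_append_ConsD[of E "x # as" u "bs @ [z]"] by simp_all
    show ?thesis
    proof (cases "length bs \<le> length as")
      case True
      obtain l where ends: "chordless_ends E x as u l" "Suc (length as) \<le> 2 ^ l"
        using less.hyps[OF _ left] ys_split by auto
      from ends(1) right(1) anticomplete_as have "chordless_ends E x ys z (Suc l)"
        unfolding ys_split by (rule chordless_ends_extend_right)
      then show ?thesis using True ys_split ends(2) by (intro exI[of _ "Suc l"]) simp
    next
      case False
      obtain l where ends: "chordless_ends E u bs z l" "Suc (length bs) \<le> 2 ^ l"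
        using less.hyps[OF _ right] ys_split by auto
      have "chordless_ends E x ys z (Suc l)"
        using chordless_ends_extend_left[OF ends(1) adjacent no_later] \<open>x \<notin> set ys\<close> ys_split
        by simp
      then show ?thesis using False ys_split ends(2) by (intro exI[of _ "Suc l"]) simp
    qed
  qed
qed

lemma separation_refine:
  assumes "circuit E c" "crossing_free E c" "separation E c x ys z ws" "ys \<noteq> []"
  obtains x' ys' z' ws' where "separation E c x' ys' z' ws'"
    "length ys' < length ys" "length ys \<le> 2 * length ys' + 1"
proof -
  obtain k where rotated: "rotate k c = x # ys @ z # ws"
    using assms(3) unfolding separation_def by blast
  have circuit_xz: "circuit E (x # ys @ z # ws)" using separation_imp_circuit[OF assms(3,1)] .
  then have "successively E (x # ys)" "distinct (ys @ z # ws)"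
    using successively_append_iff[of E "x # ys" "[z]"] by (auto simp: circuit_append_Cons_iff)
  then obtain as u bs where ys_split: "ys = as @ u # bs" and no_later: "\<forall>y\<in>set bs. \<not> E x y"
    and anticomplete_as: "anticomplete E (set as) (set (bs @ z # ws))"
    using last_neighbor_split[of E x ys "z # ws"] assms(4)
      separation_imp_crossing_free[OF assms(3,2)] by metis
  show ?thesis
  proof (cases "length bs \<le> length as")
    case True
    have "separation E c x as u (bs @ z # ws)"
      using rotated ys_split anticomplete_as by (auto simp: separation_def)
    then show ?thesis using that True ys_split by auto
  next
    case False
    have "rotate (length (x # as)) (rotate k c) = u # bs @ z # ws @ x # as"
      using rotate_append[of "x # as" "u # bs @ z # ws"] rotated ys_split by simp
    moreover have "anticomplete E (set bs) (set (ws @ x # as))"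
    proof -
      have "anticomplete E (set bs) (set ws)"
        by (rule anticomplete_mono[OF separation_imp_anticomplete[OF assms(3)]])
          (auto simp: ys_split)
      moreover have "anticomplete E (set bs) (set as)"
        by (rule anticomplete_mono[OF anticomplete_commute[OF anticomplete_as]]) auto
      moreover have "x \<notin> set bs" "\<forall>y\<in>set bs. \<not> E y x"
        using circuit_xz no_later E_sym by (auto simp: circuit_def path_def ys_split)
      ultimately show ?thesis unfolding anticomplete_def by auto
    qed
    ultimately have "separation E c u bs z (ws @ x # as)"
      unfolding separation_def rotate_rotate by blast
    then show ?thesis using that False ys_split by auto
  qed
qed

lemma ex_balanced_separation:
  assumes "circuit E c" "crossing_free E c"
  obtains x ys z ws where "separation E c x ys z ws"
    "length c \<le> 3 * Suc (length ys)" "3 * Suc (length ys) \<le> 2 * length c"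
proof -
  have descent: "\<exists>x ys z ws. separation E c x ys z ws \<and> length c \<le> 3 * Suc (length ys) \<and>
      3 * Suc (length ys) \<le> 2 * length c"
    if "separation E c x ys z ws" "length c \<le> 3 * Suc (length ys)" for x ys z ws
    using that
  proof (induction "length ys" arbitrary: x ys z ws rule: less_induct)
    case less
    show ?case
    proof (cases "3 * Suc (length ys) \<le> 2 * length c")
      case False
      then have "ys \<noteq> []" using assms(1) by (auto simp: circuit_def)
      from separation_refine[OF assms less.prems(1) this]
      obtain x' ys' z' ws' where "separation E c x' ys' z' ws'" "length ys' < length ys"
        "length ys \<le> 2 * length ys' + 1" .
      then show ?thesis using less.hyps False by force
    qed (use less.prems in blast)
  qed
  obtain x xs where "c = x # xs" using assms(1) by (cases c) (auto simp: circuit_def)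
  then obtain ys z where c_eq: "c = x # ys @ [z]"
    using assms(1) by (cases xs rule: rev_cases) (auto simp: circuit_def)
  then have "separation E c x ys z []"
    unfolding separation_def by (auto simp: anticomplete_def intro: exI[of _ 0])
  then show ?thesis using descent[of x ys z "[]"] that c_eq by auto
qed

lemma chordless_ends_glue:
  assumes "chordless_ends E x ys z l" "chordless_ends E z ws x m" "anticomplete E (set ys) (set ws)"
  obtains q where "chordless E q" "q \<noteq> []" "set q \<subseteq> set (x # ys @ z # ws)"
    "l + m + 2 \<le> 2 * length q"
proof -
  obtain A B where ys_tails: "chordless E (x # A)" "chordless E (z # B)"
    "set A \<subseteq> set ys" "set B \<subseteq> set ys" "l \<le> length A + length B"
    using assms(1) unfolding chordless_ends_def by blast
  obtain C D where ws_tails: "chordless E (z # C)" "chordless E (x # D)"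
    "set C \<subseteq> set ws" "set D \<subseteq> set ws" "m \<le> length C + length D"
    using assms(2) unfolding chordless_ends_def by blast
  show ?thesis
  proof (cases "length A + length D \<le> length B + length C")
    case True
    have "chordless E (rev B @ z # C)"
      using ys_tails(2) ws_tails(1) anticomplete_mono[OF assms(3) ys_tails(4) ws_tails(3)]
      by (rule chordless_rev_append)
    from that[OF this] show ?thesis using True ys_tails ws_tails by auto
  next
    case False
    have "chordless E (rev A @ x # D)"
      using ys_tails(1) ws_tails(2) anticomplete_mono[OF assms(3) ys_tails(3) ws_tails(4)]
      by (rule chordless_rev_append)
    from that[OF this] show ?thesis using False ys_tails ws_tails by auto
  qed
qed

lemma separation_ex_chordless:
  assumes "circuit E c" "crossing_free E c" "separation E c x ys z ws"
  obtains q where "chordless E q" "q \<noteq> []" "set q \<subseteq> set c"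
    "4 * (Suc (length ys) * Suc (length ws)) \<le> 4 ^ length q"
proof -
  note paths = circuit_imp_paths[OF separation_imp_circuit[OF assms(3,1)]]
  have crossing_free: "crossing_free E (x # ys @ z # ws)" "crossing_free E (z # ws @ x # ys)"
    using separation_imp_crossing_free[OF assms(3,2)]
      crossing_free_append_commute[of "x # ys" "z # ws"] by simp_all
  obtain l where ys_ends: "chordless_ends E x ys z l" "Suc (length ys) \<le> 2 ^ l"
    using crossing_free_path_chordless_ends[OF paths(1)]
      crossing_free_append_ConsD(1)[of E "x # ys" z ws] crossing_free(1) by auto
  obtain m where ws_ends: "chordless_ends E z ws x m" "Suc (length ws) \<le> 2 ^ m"
    using crossing_free_path_chordless_ends[OF paths(2)]
      crossing_free_append_ConsD(1)[of E "z # ws" x ys] crossing_free(2) by auto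
  from chordless_ends_glue[OF ys_ends(1) ws_ends(1) separation_imp_anticomplete[OF assms(3)]]
  obtain q where chordless_q: "chordless E q" "q \<noteq> []" "set q \<subseteq> set c"
    and length_q: "l + m + 2 \<le> 2 * length q"
    unfolding separation_set_length(1)[OF assms(3)] .
  have "4 * (Suc (length ys) * Suc (length ws)) \<le> 4 * (2 ^ l * 2 ^ m)"
    using mult_le_mono[OF ys_ends(2) ws_ends(2)] by simp
  also have "\<dots> = 2 ^ (l + m + 2)" by (simp add: power_add)
  also have "\<dots> \<le> 2 ^ (2 * length q)" using length_q by (rule power_increasing) simp
  finally show ?thesis using that[OF chordless_q] by (simp add: power_mult)
qed

lemma crossing_free_circuit_ex_chordless:
  assumes "circuit E c" "crossing_free E c"
  obtains q where "chordless E q" "q \<noteq> []" "set q \<subseteq> set c"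
    "8 * (length c)\<^sup>2 \<le> 9 * 4 ^ length q"
proof -
  obtain x ys z ws where separation: "separation E c x ys z ws"
    and balanced: "length c \<le> 3 * Suc (length ys)" "3 * Suc (length ys) \<le> 2 * length c"
    using ex_balanced_separation[OF assms] .
  obtain q where chordless_q: "chordless E q" "q \<noteq> []" "set q \<subseteq> set c"
    and length_q: "4 * (Suc (length ys) * Suc (length ws)) \<le> 4 ^ length q"
    using separation_ex_chordless[OF assms separation] .
  have "length c = Suc (length ys) + Suc (length ws)"
    using separation_set_length(2)[OF separation] by simp
  then have "2 * (length c)\<^sup>2 \<le> 9 * (Suc (length ys) * Suc (length ws))"
    using balanced_product_ge[of "Suc (length ys)" "Suc (length ws)"] balanced by simp
  then have "8 * (length c)\<^sup>2 \<le> 9 * 4 ^ length q" using length_q by linarith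
  then show ?thesis using that chordless_q by blast
qed

end

section \<open>Path length and longest circuits\<close>

lemma length_path_le_detours:
  assumes "path E p" "hd p \<in> S" "last p \<in> S"
    and detour: "\<And>x as z. \<lbrakk>path E (x # as @ [z]); x \<in> S; z \<in> S; set as \<inter> S = {}\<rbrakk>
      \<Longrightarrow> k * Suc (length as) \<le> b"
  shows "k * (length p - 1) \<le> (card (set p \<inter> S) - 1) * b"
  using assms(1-3)
proof (induction "length p" arbitrary: p rule: less_induct)
  case less
  obtain x p' where p_eq: "p = x # p'" using less.prems(1) by (cases p) (auto simp: path_def)
  show ?case
  proof (cases "p' = []")
    case False
    then have "\<exists>z\<in>set p'. z \<in> S" using less.prems(3) p_eq by (metis last_ConsR last_in_set)
    from split_list_first_prop[OF this] obtain as z bs where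
      p'_split: "p' = as @ z # bs" and z_in: "z \<in> S" and as_avoids: "\<forall>y\<in>set as. y \<notin> S" by blast
    let ?rest = "z # bs"
    have "path E (x # as @ [z])" "path E ?rest"
      using path_append_ConsD[of E "x # as" z bs] less.prems(1) p_eq p'_split by simp_all
    then have first: "k * Suc (length as) \<le> b"
      and rest: "k * (length ?rest - 1) \<le> (card (set ?rest \<inter> S) - 1) * b"
      using detour[of x as z] less.hyps[of ?rest] less.prems(2,3) p_eq p'_split z_in as_avoids
      by auto
    have "set p \<inter> S = insert x (set ?rest \<inter> S)" "x \<notin> set ?rest"
      using less.prems(1,2) p_eq p'_split as_avoids by (auto simp: path_def)
    then have "card (set p \<inter> S) = Suc (card (set ?rest \<inter> S))" by simp
    moreover have "0 < card (set ?rest \<inter> S)" using z_in by (auto simp: card_gt_0_iff)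
    ultimately have "card (set p \<inter> S) - 1 = Suc (card (set ?rest \<inter> S) - 1)" by linarith
    then show ?thesis using first rest p_eq p'_split by (simp add: algebra_simps)
  qed (use p_eq in simp)
qed

context symmetric_relation
begin

lemma circuit_reroute:
  assumes "circuit E (x # ys @ z # ws)" "path E (x # as @ [z])"
    and "set as \<inter> set (x # ys @ z # ws) = {}"
  shows "circuit E (x # as @ z # ws)" "circuit E (x # as @ z # rev ys)"
  using assms successively_rev_iff[of "x # ys @ [z]"]
  by (auto simp: circuit_append_Cons_iff path_def)

lemma twice_ear_length_le:
  assumes "circuit E c" "path E (x # as @ [z])" "x \<in> set c" "z \<in> set c" "set as \<inter> set c = {}"
    and longest: "\<And>c. circuit E c \<Longrightarrow> length c \<le> M"
  shows "2 * Suc (length as) + length c \<le> 2 * M"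
proof -
  have "x \<noteq> z" using assms(2) by (auto simp: path_def)
  from circuit_split_at[OF assms(1,3,4) this] obtain ys ws where
    circuit_xz: "circuit E (x # ys @ z # ws)" and set_c: "set (x # ys @ z # ws) = set c"
    and length_c: "length (x # ys @ z # ws) = length c" .
  from assms(5) have "set as \<inter> set (x # ys @ z # ws) = {}" unfolding set_c .
  from circuit_reroute[OF circuit_xz assms(2) this]
  have "length (x # as @ z # ws) \<le> M" "length (x # as @ z # rev ys) \<le> M"
    by (simp_all only: longest)
  then show ?thesis using length_c by simp
qed

lemma length_path_le_longest_circuit:
  assumes "path E p" "circuit E c" "hd p \<in> set c" "last p \<in> set c"
    and longest: "\<And>c. circuit E c \<Longrightarrow> length c \<le> M"
  shows "2 * (length p - 1) \<le> M * (M - 1)"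
proof -
  let ?m = "length c"
  obtain d where M_eq: "M = ?m + d" using longest[OF assms(2)] le_Suc_ex by blast
  have "2 * (length p - 1) \<le> (card (set p \<inter> set c) - 1) * (2 * M - ?m)"
  proof (rule length_path_le_detours[OF assms(1,3,4)])
    fix x as z
    assume "path E (x # as @ [z])" "x \<in> set c" "z \<in> set c" "set as \<inter> set c = {}"
    from twice_ear_length_le[OF assms(2) this longest]
    show "2 * Suc (length as) \<le> 2 * M - ?m" by simp
  qed
  also have "\<dots> \<le> (?m - 1) * (2 * M - ?m)"
    by (intro mult_le_mono diff_le_mono order.refl order.trans[OF card_mono card_length]) auto
  also have "\<dots> \<le> (?m - 1) * (2 * M - ?m) + d * Suc d" by simp
  also have "\<dots> = M * (M - 1)"
    using assms(2) unfolding M_eq by (cases ?m) (auto simp: circuit_def algebra_simps)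
  finally show ?thesis .
qed

lemma circuit_extend_to_neighbor:
  assumes "circuit E c" "s \<in> set c" "u \<in> set c" "E u v"
    and path_q: "path E q" "hd q = v" "last q = s" "u \<notin> set q"
  shows "\<exists>c'. circuit E c' \<and> s \<in> set c' \<and> v \<in> set c'"
proof (cases "v \<in> set c")
  case True
  then show ?thesis using assms(1,2) by blast
next
  case False
  have "\<exists>z\<in>set q. z \<in> set c" using assms(2) path_q by (metis last_in_set path_def)
  from split_list_first_prop[OF this] obtain as z bs where
    split: "q = as @ z # bs" "z \<in> set c" "\<forall>y\<in>set as. y \<notin> set c" by blast
  obtain as' where as_eq: "as = v # as'" using split path_q(2) False by (cases as) auto
  have "u \<noteq> z" using split(1) path_q(4) by auto
  from circuit_split_at[OF assms(1,3) split(2) this] obtain ys ws where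
    circuit_uz: "circuit E (u # ys @ z # ws)" and set_c: "set (u # ys @ z # ws) = set c" by metis
  have "path E (u # as @ [z])"
    using path_append_ConsD(1)[of E as z bs] path_q(1,4) split(1) as_eq assms(4)
    by (auto simp: path_def)
  moreover have "set as \<inter> set (u # ys @ z # ws) = {}" using split(3) set_c by auto
  ultimately have "circuit E (u # as @ z # ws)" "circuit E (u # as @ z # rev ys)"
    using circuit_reroute[OF circuit_uz] by blast+
  moreover have "s \<in> set (u # as @ z # ws) \<or> s \<in> set (u # as @ z # rev ys)"
    using assms(2) set_c by auto
  moreover have "v \<in> set (u # as @ z # ws)" "v \<in> set (u # as @ z # rev ys)" using as_eq by auto
  ultimately show ?thesis by blast
qed

lemma path_ends_on_common_circuit:
  assumes avoid: "\<And>u v w. \<lbrakk>{u, v, w} \<subseteq> V; v \<noteq> u; w \<noteq> u\<rbrakk> \<Longrightarrow>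
      \<exists>q. path E q \<and> hd q = v \<and> last q = w \<and> u \<notin> set q"
    and "path E p" "2 \<le> length p" "set p \<subseteq> V"
  shows "\<exists>c. circuit E c \<and> hd p \<in> set c \<and> last p \<in> set c"
  using assms(2-4)
proof (induction p rule: rev_induct)
  case (snoc v p)
  then have "p \<noteq> []" by auto
  then have path_p: "path E p" and "E (last p) v" and "v \<noteq> last p"
    using snoc.prems(1) by (auto simp: path_def successively_append_iff)
  show ?case
  proof (cases "length p = 1")
    case True
    then obtain s where "p = [s]" by (auto simp: length_Suc_conv)
    then have "circuit E [s, v]"
      using circuit_edge[of E s v] \<open>E (last p) v\<close> \<open>v \<noteq> last p\<close> E_sym by simp
    then show ?thesis using \<open>p = [s]\<close> by (intro exI[of _ "[s, v]"]) simp
  next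
    case False
    then have length_p: "2 \<le> length p" using \<open>p \<noteq> []\<close> by (cases p) (auto simp: Suc_le_eq)
    then obtain c where circuit_c: "circuit E c" "hd p \<in> set c" "last p \<in> set c"
      using snoc.IH[OF path_p] snoc.prems(3) by auto
    have "hd p \<noteq> last p" using length_p path_p by (cases p) (auto simp: path_def)
    moreover have "{last p, v, hd p} \<subseteq> V" using snoc.prems(3) \<open>p \<noteq> []\<close> by auto
    ultimately obtain q where "path E q" "hd q = v" "last q = hd p" "last p \<notin> set q"
      using avoid \<open>v \<noteq> last p\<close> by metis
    from circuit_extend_to_neighbor[OF circuit_c \<open>E (last p) v\<close> this]
    show ?thesis using \<open>p \<noteq> []\<close> by simp
  qed
qed simp

end

section \<open>Partial 2-trees\<close>

abbreviation adj :: "'a pair_pre_digraph \<Rightarrow> 'a \<Rightarrow> 'a \<Rightarrow> bool" where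
  "adj G \<equiv> \<lambda>x y. (x, y) \<in> parcs G"

sublocale pair_sym_digraph \<subseteq> adj: symmetric_relation "adj G"
  using arcs_symmetric by unfold_locales blast

lemma (in pair_wf_digraph) circuit_subset_verts: "circuit (adj G) c \<Longrightarrow> set c \<subseteq> pverts G"
  using circuit_ex_successor in_arcsD1 by fast

lemma (in pair_fin_digraph) length_circuit_le_card_verts:
  assumes "circuit (adj G) c"
  shows "length c \<le> card (pverts G)"
proof -
  have "length c = card (set c)" using assms by (simp add: circuit_def path_def distinct_card)
  also have "\<dots> \<le> card (pverts G)"
    using pair_finite_verts circuit_subset_verts[OF assms] by (rule card_mono)
  finally show ?thesis .
qed

lemma set_vwalk_arcs_subset_iff: "set (vwalk_arcs p) \<subseteq> A \<longleftrightarrow> successively (\<lambda>x y. (x, y) \<in> A) p"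
  by (induction p rule: vwalk_arcs.induct) auto

lemma vpath_with_proj_iff: "vpath p (with_proj G) \<longleftrightarrow> path (adj G) p \<and> set p \<subseteq> pverts G"
  by (auto simp: vpath_def vwalk_def path_def set_vwalk_arcs_subset_iff)

lemma (in pair_graph) induced_vpath_if_chordless:
  assumes "chordless (adj G) q" "q \<noteq> []" "set q \<subseteq> pverts G"
  shows "induced_vpath q G"
proof -
  let ?A = "set (vwalk_arcs q)"
  have path_q: "path (adj G) q" using chordless_imp_path[OF assms(1,2)] .
  have "?A \<subseteq> set q \<times> set q" by (auto elim: in_set_vwalk_arcsE)
  moreover have "?A \<subseteq> parcs G" using path_q by (simp add: set_vwalk_arcs_subset_iff path_def)
  ultimately have "?A \<union> ?A\<inverse> \<subseteq> parcs G \<inter> set q \<times> set q" using arcs_symmetric by auto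
  moreover have "parcs G \<inter> set q \<times> set q \<subseteq> ?A \<union> ?A\<inverse>"
    using adj.chordless_adjacent_in_vwalk_arcs[OF assms(1)] no_loops' by fast
  ultimately show ?thesis
    using path_q assms(3) by (auto simp: induced_vpath_def induced_pair_def vpath_with_proj_iff)
qed

lemma (in pair_graph) pair_graph_induced_pair: "pair_graph (induced_pair G S)"
  using pair_finite_verts pair_finite_arcs in_arcsD1 in_arcsD2 pair_no_loops arcs_symmetric
  by unfold_locales (auto simp: induced_pair_def symmetric_def intro!: symI)

lemma (in pair_graph) k_connected_ex_path_avoiding:
  assumes "k_connected k G" "X \<subseteq> pverts G" "card X < k" "v \<in> pverts G - X" "w \<in> pverts G - X"
  shows "\<exists>q. path (adj G) q \<and> hd q = v \<and> last q = w \<and> set q \<inter> X = {}"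
proof -
  let ?H = "induced_pair G (- X)"
  interpret H: pair_graph ?H by (rule pair_graph_induced_pair)
  have "connected (with_proj ?H)" using assms(1-3) unfolding k_connected_def by blast
  then have "strongly_connected (with_proj ?H)"
    using H.symmetric_connected_imp_strongly_connected H.pair_sym_arcs by blast
  then have "v \<rightarrow>\<^sup>*\<^bsub>with_proj ?H\<^esub> w"
    using assms(4,5) by (auto simp: induced_pair_def)
  then obtain q where "vpath q (with_proj ?H)" "hd q = v" "last q = w"
    unfolding H.reachable_vpath_conv by blast
  then show ?thesis
    by (auto simp: vpath_with_proj_iff path_def induced_pair_def elim: successively_mono)
qed

lemma (in pair_graph) two_connected_ex_long_circuit:
  assumes "k_connected 2 G" "vpath p (with_proj G)" "2 \<le> length p"
  obtains c where "circuit (adj G) c" "2 * (length p - 1) \<le> length c * (length c - 1)"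
proof -
  have path_p: "path (adj G) p" "set p \<subseteq> pverts G"
    using assms(2) by (simp_all add: vpath_with_proj_iff)
  have avoid: "\<exists>q. path (adj G) q \<and> hd q = v \<and> last q = w \<and> u \<notin> set q"
    if "{u, v, w} \<subseteq> pverts G" "v \<noteq> u" "w \<noteq> u" for u v w
    using k_connected_ex_path_avoiding[OF assms(1), of "{u}" v w] that by auto
  obtain c where circuit_c: "circuit (adj G) c" "hd p \<in> set c" "last p \<in> set c"
    using adj.path_ends_on_common_circuit[OF avoid path_p(1) assms(3) path_p(2)] by blast
  have "\<forall>c. circuit (adj G) c \<longrightarrow> length c < Suc (card (pverts G))"
    using length_circuit_le_card_verts by (auto simp: less_Suc_eq_le)
  then obtain m where longest: "circuit (adj G) m" "\<And>c. circuit (adj G) c \<Longrightarrow> length c \<le> length m"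
    using ex_has_greatest_nat[of "circuit (adj G)" c length] circuit_c(1) by metis
  then show ?thesis using that adj.length_path_le_longest_circuit[OF path_p(1) circuit_c] by blast
qed

lemma circuit_induced_pair:
  assumes "circuit (adj G) c" "set c \<subseteq> S"
  shows "circuit (adj (induced_pair G S)) c"
  using circuit_map[OF assms(1), of id "adj (induced_pair G S)"] assms(2)
  by (auto simp: induced_pair_def)

lemma crossing_free_induced_pairD:
  assumes "crossing_free (adj (induced_pair G S)) c" "set c \<subseteq> S"
  shows "crossing_free (adj G) c"
  using crossing_free_mapD[of "adj (induced_pair G S)" id c "adj G"] assms
  by (auto simp: induced_pair_def)

lemma (in pair_graph) clique_neighborhoodD:
  assumes "complete_digraph k (with_proj (induced_pair G (neighborhood G v)))"
  shows "card (neighborhood G v) = k"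
    "\<lbrakk>x \<in> neighborhood G v; y \<in> neighborhood G v; x \<noteq> y\<rbrakk> \<Longrightarrow> adj G x y"
proof -
  have "neighborhood G v \<subseteq> pverts G" using in_arcsD2 by (auto simp: neighborhood_def)
  then show "card (neighborhood G v) = k"
    "\<lbrakk>x \<in> neighborhood G v; y \<in> neighborhood G v; x \<noteq> y\<rbrakk> \<Longrightarrow> adj G x y"
    using assms by (auto simp: complete_digraph_pair_def induced_pair_def Int_absorb1)
qed

lemma two_tree_crossing_free:
  assumes "k_tree 2 T" "circuit (adj T) c"
  shows "crossing_free (adj T) c"
  using assms
proof (induction arbitrary: c rule: k_tree.induct)
  case (clique T)
  then interpret pair_graph T by (intro pair_graphI_graph) (simp add: complete_digraph_def)
  have "length c \<le> card (pverts T)" by (rule length_circuit_le_card_verts[OF clique.prems])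
  also have "\<dots> = 2" using clique.hyps by (simp add: complete_digraph_def)
  finally show ?case by (intro crossing_free_if_length_less) simp
next
  case (extend T v)
  interpret pair_graph T by fact
  have avoiding: "crossing_free (adj T) c" if "circuit (adj T) c" "set c \<subseteq> - {v}" for c
    using extend.IH[OF circuit_induced_pair[OF that]] that(2) by (rule crossing_free_induced_pairD)
  show ?case
  proof (cases "v \<in> set c")
    case True
    then obtain k r where rotated: "rotate k c = v # r" by (rule rotate_to_front)
    then have circuit_vr: "circuit (adj T) (v # r)"
      using circuit_rotate[OF extend.prems, of k] by simp
    have neighbors_v: "neighborhood T v = {u. adj T v u}" by (simp add: neighborhood_def)
    note clique = clique_neighborhoodD[OF extend.hyps(3), unfolded neighbors_v mem_Collect_eq]
    have "crossing_free (adj T) r" if "circuit (adj T) r"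
      using avoiding[OF that] circuit_vr by (auto simp: circuit_def path_def)
    with circuit_vr clique have "crossing_free (adj T) (v # r)"
      by (rule adj.crossing_free_Cons_clique_neighbors)
    then show ?thesis using adj.crossing_free_rotate rotated by metis
  qed (use avoiding extend.prems in blast)
qed

lemma partial_k_tree_embedding:
  assumes "partial_k_tree k G"
  obtains T :: "nat pair_pre_digraph" and f where "k_tree k T" "inj_on f (pverts G)"
    "\<And>x y. adj G x y \<Longrightarrow> adj T (f x) (f y)"
proof -
  obtain T H :: "nat pair_pre_digraph" and h where k_tree_T: "k_tree k T"
    and subgraph_HT: "subgraph (with_proj H) (with_proj T)"
    and iso: "pre_digraph.digraph_isomorphism (with_proj G) h"
      "with_proj H = app_iso h (with_proj G)"
    using assms unfolding partial_k_tree_def digraph_iso_def by blast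
  have "adj T (iso_verts h x) (iso_verts h y)" if "adj G x y" for x y
  proof -
    have "arcs (with_proj H) = iso_arcs h ` arcs (with_proj G)"
      "tail (with_proj H) = iso_tail h" "head (with_proj H) = iso_head h"
      unfolding iso(2) by (simp_all add: arcs_app_iso tail_app_iso head_app_iso)
    then have "iso_arcs h (x, y) \<in> parcs H" "iso_tail h = fst" "iso_head h = snd"
      using that by auto
    moreover have "iso_verts h x = iso_tail h (iso_arcs h (x, y))"
      "iso_verts h y = iso_head h (iso_arcs h (x, y))"
      using iso(1) that unfolding pre_digraph.digraph_isomorphism_def by auto
    ultimately have "adj H (iso_verts h x) (iso_verts h y)" by simp
    then show ?thesis using subgraph_HT by (auto simp: subgraph_def)
  qed
  moreover have "inj_on (iso_verts h) (pverts G)"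
    using iso(1) unfolding pre_digraph.digraph_isomorphism_def by simp
  ultimately show ?thesis using that k_tree_T by blast
qed

lemma (in pair_graph) partial_two_tree_crossing_free:
  assumes "partial_k_tree 2 G" "circuit (adj G) c"
  shows "crossing_free (adj G) c"
proof -
  obtain T :: "nat pair_pre_digraph" and f
    where two_tree_T: "k_tree 2 T" and inj_f: "inj_on f (pverts G)"
    and hom: "\<And>x y. adj G x y \<Longrightarrow> adj T (f x) (f y)"
    using partial_k_tree_embedding[OF assms(1)] by metis
  have "inj_on f (set c)" using inj_f circuit_subset_verts[OF assms(2)] by (rule inj_on_subset)
  with assms(2) have "circuit (adj T) (map f c)"
    by (rule circuit_map[where F = "adj T"]) (rule hom)
  with two_tree_T have "crossing_free (adj T) (map f c)" by (rule two_tree_crossing_free)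
  then show ?thesis by (rule crossing_free_mapD) (rule hom)
qed

theorem theorem5:
  fixes G :: "'a pair_pre_digraph" and n :: nat
  assumes "pair_graph G"
    and "k_connected 2 G"
    and "partial_k_tree 2 G"
    and "n > 3"
    and "\<exists>p. vpath p (with_proj G) \<and> length p = n"
  shows "\<exists>q. induced_vpath q G \<and> real (length q) \<ge> log 2 (real n - 3) / 2"
proof -
  interpret pair_graph G by fact
  obtain p where path_p: "vpath p (with_proj G)" "length p = n" using assms(5) by blast
  then have "2 \<le> length p" using assms(4) by simp
  from two_connected_ex_long_circuit[OF assms(2) path_p(1) this] obtain c where
    circuit_c: "circuit (adj G) c" and n_le: "2 * (n - 1) \<le> length c * (length c - 1)"
    unfolding path_p(2) .
  obtain q where chordless_q: "chordless (adj G) q" "q \<noteq> []" "set q \<subseteq> set c"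
    and length_q: "8 * (length c)\<^sup>2 \<le> 9 * 4 ^ length q"
    using adj.crossing_free_circuit_ex_chordless[OF circuit_c]
      partial_two_tree_crossing_free[OF assms(3) circuit_c] by blast
  have "2 * (n - 1) \<le> (length c)\<^sup>2"
    using n_le by (rule order_trans) (simp add: power2_eq_square)
  then have "n - 3 \<le> 4 ^ length q" using length_q by linarith
  then have "real (n - 3) \<le> real (4 ^ length q)" by (rule of_nat_mono)
  then have "real n - 3 \<le> 2 powr (2 * real (length q))"
    using assms(4) by (simp add: powr_powr[symmetric] powr_realpow of_nat_diff)
  then have "log 2 (real n - 3) \<le> 2 * real (length q)"
    using assms(4) by (subst log_le_iff) auto
  moreover have "induced_vpath q G"
    using induced_vpath_if_chordless[OF chordless_q(1,2)] chordless_q(3)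
      circuit_subset_verts[OF circuit_c] by blast
  ultimately show ?thesis by (intro exI[of _ q]) simp
qed

end
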